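(* Let $\mathit{Exp}$ be the set of conditional expressions over a set $A$ of symbols, $\mathit{Exp}_\bot$ the corresponding flat domain, and let $norm_2:\mathit{Exp}_\bot\to\mathit{Exp}_\bot$ be a continuous (equivalently, monotone) function satisfying, for all $a\in A$ and all $u,v,w,y,z\in\mathit{Exp}$, $$norm_2(At(a))=At(a),$$ $$norm_2(\mathit{If}(At(a),y,z))=\mathit{If}(At(a),norm_2(y),norm_2(z)),$$ $$norm_2(\mathit{If}(\mathit{If}(u,v,w),y,z))=norm_2\bigl(\mathit{If}(u,\,norm_2(\mathit{If}(v,y,z)),\,norm_2(\mathit{If}(w,y,z)))\bigr).$$ Then $ISN(norm_2(x))$ holds for every $x\in\mathit{Exp}$; that is, $norm_2$ is total on defined expressions and its result is always in normal form.
   Context: Fix a set $A$ of symbols. The set $\mathit{Exp}$ of conditional expressions is the inductive type freely generated by the constructors $At(a)$ for $a\in A$ and $\mathit{If}(x,y,z)$ for $x,y,z\in\mathit{Exp}$. The flat domain $\mathit{Exp}_\bot=\mathit{Exp}\cup\{\bot\}$ adds one undefined element $\bot$, ordered by $p\sqsubseteq q$ iff $p=\bot$ or $p=q$; $\mathit{If}$ is extended strictly to $\mathit{Exp}_\bot$, so $\mathit{If}(x,y,z)=\bot$ if any of $x,y,z$ is $\bot$. The predicate $ISN$ ("is in normal form") on $\mathit{Exp}_\bot$ is defined recursively, for $a\in A$ and $u,v,w,y,z\in\mathit{Exp}$, by $$ISN(\bot)\iff\textit{false},\qquad ISN(At(a))\iff\textit{true},$$ $$ISN(\mathit{If}(At(a),y,z))\iff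 ISN(y)\wedge ISN(z),\qquad ISN(\mathit{If}(\mathit{If}(u,v,w),y,z))\iff\textit{false}.$$ *)

theory Defs
  imports "HOL-Library.Complete_Partial_Order2"
begin

datatype 'a exp = At 'a | IF "'a exp" "'a exp" "'a exp"

text \<open>
  The flat domain of expressions is rendered as \<^typ>\<open>'a exp option\<close>, with \<^term>\<open>None\<close> as the
  undefined element and \<^term>\<open>option_ord\<close> (that is, \<^term>\<open>flat_ord None\<close>) as its ordering.
\<close>

fun IF_strict :: "'a exp option \<Rightarrow> 'a exp option \<Rightarrow> 'a exp option \<Rightarrow> 'a exp option" where
  "IF_strict (Some x) (Some y) (Some z) = Some (IF x y z)"
| "IF_strict _ _ _ = None"

fun ISN :: "'a exp option \<Rightarrow> bool" where
  "ISN None = False"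
| "ISN (Some (At a)) = True"
| "ISN (Some (IF (At a) y z)) = (ISN (Some y) \<and> ISN (Some z))"
| "ISN (Some (IF (IF u v w) y z)) = False"

text \<open>On the flat domain, continuity (preservation of lubs of nonempty chains) is monotonicity.\<close>

lemma mcont_option_iff_monotone:
  "mcont (flat_lub None) option_ord (flat_lub None) option_ord f
     \<longleftrightarrow> monotone option_ord option_ord f"
  for f :: "'a option \<Rightarrow> 'b option"
proof
  assume m: "monotone option_ord option_ord f"
  have "f (flat_lub None Y) = flat_lub None (f ` Y)"
    if ch: "Complete_Partial_Order.chain option_ord Y" and ne: "Y \<noteq> {}" for Y
  proof (cases "Y \<subseteq> {None}")
    case True
    with ne have "Y = {None}" by blast
    then show ?thesis by (cases "f None") (simp_all add: flat_lub_def)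
  next
    case False
    then obtain x where x: "Some x \<in> Y" by (metis option.exhaust insertI1 subsetI)
    have "y = None \<or> y = Some x" if "y \<in> Y" for y
      using chainD[OF ch that x] by (auto simp: flat_ord_def)
    with x have Y: "Y = {Some x} \<or> Y = {None, Some x}" by blast
    have "f None = None \<or> f None = f (Some x)"
      using monotoneD[OF m, of None "Some x"] by (simp add: flat_ord_def)
    with Y show ?thesis
      by (cases "f (Some x)") (elim disjE; simp add: flat_lub_def insert_Diff_if)+
  qed
  with m show "mcont (flat_lub None) option_ord (flat_lub None) option_ord f"
    by (intro mcontI contI) auto
qed (simp add: mcont_mono)

end

theory Submission imports Defs begin

text \<open>
  Although the third equation applies \<open>norm2\<close> to results of \<open>norm2\<close>, no termination measure is
  needed: \<open>norm2\<close> fixes normal forms, so structural induction on the test \<open>x\<close> alone shows that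
  \<open>norm2\<close> normalizes \<open>IF x y z\<close> whenever it normalizes \<open>y\<close> and \<open>z\<close>.
\<close>

lemma ISN_imp_norm_fixed:
  assumes "\<And>a. f (Some (At a)) = Some (At a)"
    and "\<And>a y z. f (Some (IF (At a) y z)) = IF_strict (Some (At a)) (f (Some y)) (f (Some z))"
    and "ISN p"
  shows "f p = p"
  \<comment> \<open>\<open>ISN\<close> recurses on the branches of an atomic test, just as the
    second equation for \<open>f\<close> does.\<close>
  using assms(3) by (induction p rule: ISN.induct) (simp_all add: assms(1,2))

lemma ISN_norm_IF:
  assumes At: "\<And>a. f (Some (At a)) = Some (At a)"
    and IF_At: "\<And>a y z. f (Some (IF (At a) y z))
           = IF_strict (Some (At a)) (f (Some y)) (f (Some z))"
    and IF_IF: "\<And>u v w y z. f (Some (IF (IF u v w) y z))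
           = f (IF_strict (Some u) (f (Some (IF v y z))) (f (Some (IF w y z))))"
    and "ISN (f (Some y))" and "ISN (f (Some z))"
  shows "ISN (f (Some (IF x y z)))"
  using assms(4,5)
\<comment> \<open>The branches must vary: the hypotheses for \<open>v\<close> and \<open>w\<close>
  keep \<open>y\<close> and \<open>z\<close>, but the one for \<open>u\<close> is applied to the
  normalized branches \<open>p\<close> and \<open>q\<close>.\<close>
proof (induction x arbitrary: y z)
  case (At a)
  then show ?case
    by (cases "f (Some y)"; cases "f (Some z)") (simp_all add: IF_At)
next
  case (IF u v w)
  have v: "ISN (f (Some (IF v y z)))" and w: "ISN (f (Some (IF w y z)))"
    using IF by blast+
  then obtain p q where p: "f (Some (IF v y z)) = Some p" and q: "f (Some (IF w y z)) = Some q"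
    by (metis ISN.simps(1) option.exhaust)
  \<comment> \<open>The hypothesis for \<open>u\<close> asks that \<open>f (Some p)\<close> and
    \<open>f (Some q)\<close> be normal; what is known is that \<open>p\<close> and \<open>q\<close>
    themselves are.\<close>
  have "f (Some p) = Some p" "f (Some q) = Some q"
    using v w p q ISN_imp_norm_fixed[of f, OF At IF_At] by metis+
  then have "ISN (f (Some (IF u p q)))"
    using IF.IH(1) v w p q by simp
  then show ?case by (simp add: IF_IF p q)
qed

theorem mainTheorem4:
  fixes norm2 :: "'a exp option \<Rightarrow> 'a exp option"
  assumes "monotone option_ord option_ord norm2"
    and "\<And>a. norm2 (Some (At a)) = Some (At a)"
    and "\<And>a y z. norm2 (Some (IF (At a) y z))
           = IF_strict (Some (At a)) (norm2 (Some y)) (norm2 (Some z))"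
    and "\<And>u v w y z. norm2 (Some (IF (IF u v w) y z))
           = norm2 (IF_strict (Some u) (norm2 (Some (IF v y z))) (norm2 (Some (IF w y z))))"
  shows "\<forall>x. ISN (norm2 (Some x))"
proof
  fix x
  show "ISN (norm2 (Some x))"
  proof (induction x)
    case (At a)
    then show ?case by (simp add: assms(2))
  next
    case (IF x y z)
    then show ?case using ISN_norm_IF[of norm2, OF assms(2-4)] by blast
  qed
qed

end
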